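(* Let $\mathcal{C}_0$ be a quasi self-dual code of length $n$ over $I_5$ with generator matrix $G_0=(\mathbf{r}_i)$, where $\mathbf{r}_i$ is the $i$th row of $G_0$ for $i=1,2,\dots,m$. If $\mathbf{x}\in\mathbb{F}_5^n$ and $\mu,\nu\in J=\{0,\mathtt{b},2\mathtt{b},3\mathtt{b},4\mathtt{b}\}$ are nonzero elements, then the code $\mathcal{C}$ over $I_5$ with generator matrix $$G=\left(\begin{array}{cc|c} 4\mu&0&\mu\mathbf{x}\\ 0&2\nu&\nu\mathbf{x}\\ \hline (\mathbf{x},\mathbf{r}_1)&2(\mathbf{x},\mathbf{r}_1)&\mathbf{r}_1\\ \vdots&\vdots&\vdots\\ (\mathbf{x},\mathbf{r}_m)&2(\mathbf{x},\mathbf{r}_m)&\mathbf{r}_m\end{array}\right)$$ is a quasi self-dual code of length $n+2$.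
   Context: $I_5$ is the commutative ring without unity of order 25 and characteristic 5 generated by $\mathtt{a},\mathtt{b}$ with relations $5\mathtt{a}=5\mathtt{b}=0$, $\mathtt{a}^2=\mathtt{b}$, $\mathtt{a}\mathtt{b}=0$ (hence $\mathtt{b}^2=0$); every element is uniquely $\mathtt{a}x+\mathtt{b}y$ with $x,y\in\mathbb{F}_5$. $J=\{j\mathtt{b}:0\le j<5\}$ is its maximal ideal. $\mathbb{F}_5$ acts naturally on $I_5$ by repeated addition. A linear code of length $n$ over $I_5$ is an $I_5$-submodule of $I_5^n$; the code with generator matrix $G$ is the smallest $I_5$-submodule (additive subgroup closed under multiplication by $I_5$) containing the rows of $G$. For $\mathbf{x}\in\mathbb{F}_5^n$, $\mathbf{r}\in I_5^n$, $(\mathbf{x},\mathbf{r})=\sum_i x_ir_i\in I_5$; for $\mathbf{y},\mathbf{z}\in I_5^n$, $(\mathbf{y},\mathbf{z})=\sum_i y_iz_i$. For $\nu\in I_5$ and $\mathbf{x}\in\mathbb{F}_5^n$, $\nu\mathbf{x}=(\nu x_1,\dots,\nu x_n)$. A code $\mathcal{C}$ is self-orthogonal if $(\mathbf{y},\mathbf{z})=0$ for all $\mathbf{y},\mathbf{z}\in\mathcal{C}$. A quasi self-dual code of length $n$ is a self-orthogonal code of length $n$ of size $5^n$. *)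

theory Defs
  imports "HOL-Library.Numeral_Type" "Jordan_Normal_Form.Matrix"
begin

section \<open>The non-unital ring of order 25 and characteristic 5\<close>

text \<open>
  The field with five elements is the type \<^typ>\<open>5\<close> of integers modulo 5. \<open>I5 x y\<close> stands for the
  element \<open>a x + b y\<close>; multiplication is the bilinear one with \<open>a\<^sup>2 = b\<close>, \<open>a b = 0\<close> and \<open>b\<^sup>2 = 0\<close>.
  The class \<^class>\<open>comm_ring\<close> does not ask for a unit.
\<close>

datatype i5 = I5 (acoeff: 5) (bcoeff: 5)

instantiation i5 :: comm_ring
begin

definition zero_i5 :: i5 where "0 = I5 0 0"

definition plus_i5 :: "i5 \<Rightarrow> i5 \<Rightarrow> i5"
  where "u + v = I5 (acoeff u + acoeff v) (bcoeff u + bcoeff v)"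

definition uminus_i5 :: "i5 \<Rightarrow> i5"
  where "- u = I5 (- acoeff u) (- bcoeff u)"

definition minus_i5 :: "i5 \<Rightarrow> i5 \<Rightarrow> i5"
  where "u - v = I5 (acoeff u - acoeff v) (bcoeff u - bcoeff v)"

definition times_i5 :: "i5 \<Rightarrow> i5 \<Rightarrow> i5"
  where "u * v = I5 0 (acoeff u * acoeff v)"

instance
  by standard
     (simp_all add: zero_i5_def plus_i5_def uminus_i5_def minus_i5_def times_i5_def algebra_simps)

end

definition gen_a :: i5 where "gen_a = I5 1 0"

definition gen_b :: i5 where "gen_b = I5 0 1"

text \<open>
  The action of the prime field by repeated addition: \<open>Rep_bit1 k\<close> is the representative of \<open>k\<close>
  in \<open>{0..<5}\<close>.
\<close>

definition act :: "5 \<Rightarrow> i5 \<Rightarrow> i5" (infixr "*\<^sub>5" 75)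
  where "k *\<^sub>5 r = (((+) r) ^^ nat (Rep_bit1 k)) 0"

definition J5 :: "i5 set" where "J5 = {j *\<^sub>5 gen_b | j. True}"

lemma act_I5: "k *\<^sub>5 I5 x y = I5 (k * x) (k * y)"
proof -
  have iter: "(((+) (I5 x y)) ^^ m) 0 = I5 (of_nat m * x) (of_nat m * y)" for m
    by (induction m) (simp_all add: zero_i5_def plus_i5_def algebra_simps)
  have "of_nat (nat (Rep_bit1 k)) = k"
    by (cases k rule: bit1.cases) (simp add: bit1.Rep_Abs_mod bit1.of_int_eq Abs_bit1_inverse)
  then show ?thesis by (simp add: act_def iter)
qed

lemma i5_relations:
  "gen_a * gen_a = gen_b" "gen_a * gen_b = 0" "gen_b * gen_b = 0"
  "gen_a + gen_a + gen_a + gen_a + gen_a = 0" "gen_b + gen_b + gen_b + gen_b + gen_b = 0"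
  by (simp_all add: gen_a_def gen_b_def times_i5_def plus_i5_def zero_i5_def)

lemma i5_unique_repr: "\<exists>!(x, y). r = x *\<^sub>5 gen_a + y *\<^sub>5 gen_b"
  by (cases r) (auto simp: gen_a_def gen_b_def act_I5 plus_i5_def)

lemma i5_no_unit: "\<not> (\<exists>e :: i5. \<forall>r. e * r = r)"
proof
  assume "\<exists>e :: i5. \<forall>r. e * r = r"
  then obtain e :: i5 where "e * gen_a = gen_a" by blast
  then show False by (simp add: gen_a_def times_i5_def)
qed

lemma J5_eq: "J5 = {0, gen_b, 2 *\<^sub>5 gen_b, 3 *\<^sub>5 gen_b, 4 *\<^sub>5 gen_b}"
proof -
  have five: "j = 0 \<or> j = 1 \<or> j = 2 \<or> j = 3 \<or> j = 4" for j :: 5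
  proof (cases j rule: bit1.cases)
    case (1 z)
    then have "z = 0 \<or> z = 1 \<or> z = 2 \<or> z = 3 \<or> z = 4" by auto
    then show ?thesis using 1 by auto
  qed
  show ?thesis
  proof (intro Set.set_eqI iffI)
    fix r assume "r \<in> J5"
    then obtain j where "r = j *\<^sub>5 gen_b" by (auto simp: J5_def)
    with five[of j] show "r \<in> {0, gen_b, 2 *\<^sub>5 gen_b, 3 *\<^sub>5 gen_b, 4 *\<^sub>5 gen_b}"
      by (auto simp: gen_b_def act_I5 zero_i5_def)
  next
    fix r assume "r \<in> {0, gen_b, 2 *\<^sub>5 gen_b, 3 *\<^sub>5 gen_b, 4 *\<^sub>5 gen_b}"
    moreover have "0 = 0 *\<^sub>5 gen_b" "gen_b = 1 *\<^sub>5 gen_b"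
      by (simp_all add: gen_b_def act_I5 zero_i5_def)
    ultimately show "r \<in> J5" unfolding J5_def by blast
  qed
qed

section \<open>Codes\<close>

definition linear_code :: "nat \<Rightarrow> i5 vec set \<Rightarrow> bool"
  where "linear_code n C \<longleftrightarrow> C \<subseteq> carrier_vec n \<and> 0\<^sub>v n \<in> C \<and>
    (\<forall>u\<in>C. \<forall>v\<in>C. u + v \<in> C) \<and> (\<forall>u\<in>C. - u \<in> C) \<and> (\<forall>c. \<forall>u\<in>C. c \<cdot>\<^sub>v u \<in> C)"

text \<open>
  The rows belong to the generated code by fiat: without a unit, the \<open>I5\<close>-linear combinations
  of the rows need not contain the rows themselves.
\<close>

definition code_gen_by :: "i5 mat \<Rightarrow> i5 vec set"
  where "code_gen_by G = \<Inter> {C. linear_code (dim_col G) C \<and> set (rows G) \<subseteq> C}"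

definition self_orthogonal :: "i5 vec set \<Rightarrow> bool"
  where "self_orthogonal C \<longleftrightarrow> (\<forall>y\<in>C. \<forall>z\<in>C. y \<bullet> z = 0)"

definition quasi_self_dual :: "nat \<Rightarrow> i5 vec set \<Rightarrow> bool"
  where "quasi_self_dual n C \<longleftrightarrow> linear_code n C \<and> self_orthogonal C \<and> card C = 5 ^ n"

definition mixed_prod :: "5 vec \<Rightarrow> i5 vec \<Rightarrow> i5"
  where "mixed_prod x r = (\<Sum>i = 0..<dim_vec r. (x $ i) *\<^sub>5 (r $ i))"

definition scale_by :: "i5 \<Rightarrow> 5 vec \<Rightarrow> i5 vec"
  where "scale_by \<nu> x = map_vec (\<lambda>c. c *\<^sub>5 \<nu>) x"

end

theory Submission
  imports Defs
begin

text \<open>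
  The generated code is \<open>{s b (4, 0, x) + t b (0, 2, x) + ((x, r), 2 (x, r), r) | s t r. r \<in> C\<^sub>0}\<close>.
  It is self-orthogonal because \<open>J\<close> annihilates the ring, so that the inner product of two codewords
  is \<open>(1 + 2\<^sup>2) (x, r) (x, r') + (r, r') = 0\<close>. The parametrisation by \<open>(s, t, r)\<close> is injective:
  subtracting the second coordinate from twice the first gives \<open>8 s - 2 t = 3 (s + t)\<close>, independently
  of \<open>r\<close>; hence \<open>s + t\<close>, then \<open>r\<close>, then \<open>s\<close> and \<open>t\<close> are determined.
\<close>

section \<open>Coefficients in the ring and arithmetic modulo 5\<close>

lemma acoeff_simps [simp]:
  "acoeff 0 = 0" "acoeff (u + v) = acoeff u + acoeff v" "acoeff (- u) = - acoeff u"
  "acoeff (u * v) = 0" "acoeff (k *\<^sub>5 u) = k * acoeff u"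
  by (cases u; simp add: zero_i5_def plus_i5_def uminus_i5_def times_i5_def act_I5)+

lemma bcoeff_simps [simp]:
  "bcoeff 0 = 0" "bcoeff (u + v) = bcoeff u + bcoeff v" "bcoeff (- u) = - bcoeff u"
  "bcoeff (u * v) = acoeff u * acoeff v" "bcoeff (k *\<^sub>5 u) = k * bcoeff u"
  by (cases u; simp add: zero_i5_def plus_i5_def uminus_i5_def times_i5_def act_I5)+

lemma J5_nonzeroE:
  assumes "\<mu> \<in> J5" and "\<mu> \<noteq> 0"
  obtains j where "\<mu> = I5 0 j" and "j \<noteq> 0"
  using assms by (auto simp: J5_def gen_b_def act_I5 zero_i5_def)

lemma five_cases:
  fixes j :: 5
  obtains "j = 0" | "j = 1" | "j = 2" | "j = 3" | "j = 4"
proof (cases j rule: bit1.cases)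
  case (1 z)
  then have "z = 0 \<or> z = 1 \<or> z = 2 \<or> z = 3 \<or> z = 4" by auto
  with 1 that show thesis by auto
qed

text \<open>A nonzero \<open>j\<close> is invertible modulo 5. The multiplier is wanted as a natural
  number because elements of \<open>J5\<close> are annihilated by ring multiplication, so their
  multiples inside a code come only from repeated addition.\<close>

lemma five_nat_multiple:
  fixes j s :: 5
  assumes "j \<noteq> 0"
  obtains m where "s = of_nat m * j"
proof -
  have "\<exists>d :: nat. of_nat d * j = 1"
  proof (cases j rule: five_cases)
    \<comment> \<open>Case number i stands for \<open>j\<close> = i - 1; the witnesses 1, 3, 2, 4
      are the inverses of 1, 2, 3, 4 modulo 5.\<close>
    case 2 then show ?thesis by (intro exI[of _ 1]) simp
  next
    case 3 then show ?thesis by (intro exI[of _ 3]) simp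
  next
    case 4 then show ?thesis by (intro exI[of _ 2]) simp
  next
    case 5 then show ?thesis by (intro exI[of _ 4]) simp
  qed (use assms in simp)
  then obtain d :: nat where d: "of_nat d * j = 1" by blast
  have "\<exists>k :: nat. s = of_nat k"
  proof (cases s rule: five_cases)
    case 1 then show ?thesis by (intro exI[of _ 0]) simp
  next
    case 2 then show ?thesis by (intro exI[of _ 1]) simp
  next
    case 3 then show ?thesis by (intro exI[of _ 2]) simp
  next
    case 4 then show ?thesis by (intro exI[of _ 3]) simp
  next
    case 5 then show ?thesis by (intro exI[of _ 4]) simp
  qed
  then obtain k :: nat where k: "s = of_nat k" by blast
  have "s = of_nat (k * d) * j"
    using d k by (simp add: mult.assoc)
  then show thesis by (rule that)
qed

text \<open>Serves to discard multiples of 5 with symbolic cofactors, after an identity has been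
  arranged over the integers.\<close>

lemma five_times_eq_0: "5 * (k :: 5) = 0"
  by (cases k rule: five_cases) simp_all

section \<open>Linearity of the mixed product\<close>

lemma mixed_prod_add:
  assumes "r \<in> carrier_vec n" "r' \<in> carrier_vec n"
  shows "mixed_prod x (r + r') = mixed_prod x r + mixed_prod x r'"
proof -
  have "(x $ i) *\<^sub>5 ((r + r') $ i) = (x $ i) *\<^sub>5 (r $ i) + (x $ i) *\<^sub>5 (r' $ i)" if "i < n" for i
    using assms that by (auto simp: i5.expand algebra_simps)
  with assms show ?thesis by (simp add: mixed_prod_def flip: sum.distrib)
qed

lemma mixed_prod_smult: "mixed_prod x (c \<cdot>\<^sub>v r) = c * mixed_prod x r"
  unfolding mixed_prod_def sum_distrib_left
  by (rule sum.cong) (auto simp: i5.expand algebra_simps)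

lemma mixed_prod_zero [simp]: "mixed_prod x (0\<^sub>v n) = 0"
  unfolding mixed_prod_def by (rule sum.neutral) (auto simp: i5.expand)

lemma mixed_prod_uminus: "mixed_prod x (- r) = - mixed_prod x r"
  unfolding mixed_prod_def sum_negf[symmetric]
  by (rule sum.cong) (auto simp: i5.expand)

section \<open>The generated code as the least linear code containing the rows\<close>

lemma linear_code_code_gen_by: "linear_code (dim_col G) (code_gen_by G)"
proof -
  \<comment> \<open>The full space belongs to the intersected family, which keeps the intersection
    inside the carrier.\<close>
  have "linear_code (dim_col G) (carrier_vec (dim_col G))"
    by (auto simp: linear_code_def)
  moreover have "set (rows G) \<subseteq> carrier_vec (dim_col G)"
    by (auto simp: rows_def)
  ultimately show ?thesis
    unfolding code_gen_by_def linear_code_def by blast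
qed

lemma rows_subset_code_gen_by: "set (rows G) \<subseteq> code_gen_by G"
  by (auto simp: code_gen_by_def)

lemma code_gen_by_subset:
  assumes "linear_code (dim_col G) C" and "set (rows G) \<subseteq> C"
  shows "code_gen_by G \<subseteq> C"
  using assms by (auto simp: code_gen_by_def)

section \<open>Arithmetic of vectors with a prepended coordinate\<close>

lemma vCons_add:
  "dim_vec v = dim_vec w \<Longrightarrow> vCons (a :: 'a :: plus) v + vCons b w = vCons (a + b) (v + w)"
  by (intro eq_vecI) (auto simp: vec_index_vCons)

lemma vCons_smult: "c \<cdot>\<^sub>v vCons (a :: 'a :: times) v = vCons (c * a) (c \<cdot>\<^sub>v v)"
  by (intro eq_vecI) (auto simp: vec_index_vCons)

lemma vCons_uminus: "- vCons (a :: 'a :: uminus) v = vCons (- a) (- v)"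
  by (intro eq_vecI) (auto simp: vec_index_vCons)

text \<open>The parameters \<open>s\<close> and \<open>t\<close> are the b-coefficients of the
  multiples of the two upper rows, so \<open>\<mu>\<close> and \<open>\<nu>\<close> are absorbed
  into them. Both upper rows end in a multiple of \<open>x\<close>, hence the sum
  \<open>s + t\<close>.\<close>

definition codeword :: "5 vec \<Rightarrow> 5 \<Rightarrow> 5 \<Rightarrow> i5 vec \<Rightarrow> i5 vec"
  where "codeword x s t r =
    vCons (I5 0 (4 * s) + mixed_prod x r)
      (vCons (I5 0 (2 * t) + 2 *\<^sub>5 mixed_prod x r) (r + scale_by (I5 0 (s + t)) x))"

section \<open>Algebra of codewords for a fixed \<open>x\<close>\<close>

context
  fixes x :: "5 vec" and n :: nat
  assumes x: "x \<in> carrier_vec n"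
begin

lemma codeword_carrier: "r \<in> carrier_vec n \<Longrightarrow> codeword x s t r \<in> carrier_vec (n + 2)"
  using x by (simp add: codeword_def scale_by_def)

lemma scale_by_zero: "scale_by (I5 0 0) x = 0\<^sub>v n"
  using x by (intro eq_vecI) (auto simp: scale_by_def i5.expand)

lemma codeword_zero: "codeword x 0 0 (0\<^sub>v n) = 0\<^sub>v (n + 2)"
  by (simp add: codeword_def scale_by_zero zero_vec_Suc) (simp add: i5.expand)

lemma codeword_add:
  assumes "r \<in> carrier_vec n" "r' \<in> carrier_vec n"
  shows "codeword x s t r + codeword x s' t' r' = codeword x (s + s') (t + t') (r + r')"
proof -
  have "(r + scale_by (I5 0 (s + t)) x) + (r' + scale_by (I5 0 (s' + t')) x)
      = (r + r') + scale_by (I5 0 ((s + s') + (t + t'))) x"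
    using assms x by (intro eq_vecI) (auto simp: scale_by_def i5.expand algebra_simps)
  then show ?thesis
    using assms x
    by (simp add: codeword_def vCons_add mixed_prod_add scale_by_def)
      (simp add: i5.expand algebra_simps)
qed

lemma codeword_uminus:
  assumes "r \<in> carrier_vec n"
  shows "- codeword x s t r = codeword x (- s) (- t) (- r)"
proof -
  have "- (r + scale_by (I5 0 (s + t)) x) = - r + scale_by (I5 0 (- s + - t)) x"
    using assms x by (intro eq_vecI) (auto simp: scale_by_def i5.expand algebra_simps)
  then show ?thesis
    by (simp add: codeword_def vCons_uminus mixed_prod_uminus)
      (simp add: i5.expand algebra_simps)
qed

text \<open>A product in the ring sees only a-coefficients, and the contributions of
  \<open>s\<close> and \<open>t\<close> have none, so they vanish.\<close>

lemma codeword_smult: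
  assumes "r \<in> carrier_vec n"
  shows "c \<cdot>\<^sub>v codeword x s t r = codeword x 0 0 (c \<cdot>\<^sub>v r)"
proof -
  have "c \<cdot>\<^sub>v (r + scale_by (I5 0 (s + t)) x) = c \<cdot>\<^sub>v r + scale_by (I5 0 (0 + 0)) x"
    using assms x by (intro eq_vecI) (auto simp: scale_by_def i5.expand algebra_simps)
  then show ?thesis
    by (simp add: codeword_def vCons_smult mixed_prod_smult)
      (simp add: i5.expand algebra_simps)
qed

lemma codeword_scalar_prod:
  assumes "r \<in> carrier_vec n" "r' \<in> carrier_vec n"
  shows "codeword x s t r \<bullet> codeword x s' t' r' = r \<bullet> r'"
proof -
  have "(r + scale_by (I5 0 (s + t)) x) \<bullet> (r' + scale_by (I5 0 (s' + t')) x) = r \<bullet> r'"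
    unfolding scalar_prod_def using assms x
    by (intro sum.cong) (auto simp: scale_by_def i5.expand)
  moreover have "(I5 0 (4 * s) + p) * (I5 0 (4 * s') + p')
      + (I5 0 (2 * t) + 2 *\<^sub>5 p) * (I5 0 (2 * t') + 2 *\<^sub>5 p') = 0" for p p'
    using five_times_eq_0[of "acoeff p * acoeff p'"]
    by (intro i5.expand) (simp add: algebra_simps)
  ultimately show ?thesis
    \<comment> \<open>Reassociating groups the products of the first two coordinates, whose sum is
      0.\<close>
    by (simp add: codeword_def flip: add.assoc)
qed

lemma codeword_inject:
  assumes "r \<in> carrier_vec n" "r' \<in> carrier_vec n" and "codeword x s t r = codeword x s' t' r'"
  shows "s = s' \<and> t = t' \<and> r = r'"
proof -
  \<comment> \<open>Since \<open>s\<close> and \<open>t\<close> affect only b-coefficients, the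
    first two coordinates are compared there.\<close>
  define p p' where "p = bcoeff (mixed_prod x r)" and "p' = bcoeff (mixed_prod x r')"
  have 1: "4 * s + p = 4 * s' + p'" and 2: "2 * t + 2 * p = 2 * t' + 2 * p'"
    and 3: "r + scale_by (I5 0 (s + t)) x = r' + scale_by (I5 0 (s' + t')) x"
    using assms(3) unfolding codeword_def vCons_eq_vCons p_def p'_def
    by (auto dest: arg_cong[where f = bcoeff])
  \<comment> \<open>The inner difference eliminates \<open>q\<close> and leaves 8 a - 2 b = 3 (a +
    b); the outer 2 is the inverse of 3 modulo 5.\<close>
  have sum: "a + b = 2 * (2 * (4 * a + q) - (2 * b + 2 * q))" for a b q :: 5
  proof -
    have "2 * (2 * (4 * a + q) - (2 * b + 2 * q)) = (a + b) + 5 * (3 * a - b)"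
      by (simp add: algebra_simps)
    then show ?thesis by (simp only: five_times_eq_0 add_0_right)
  qed
  have st: "s + t = s' + t'"
    unfolding sum[of s t p] sum[of s' t' p'] 1 2 ..
  have "r = r'"
  proof (rule eq_vecI)
    fix i assume "i < dim_vec r'"
    then have "i < n" using assms by simp
    \<comment> \<open>Equal sums \<open>s + t\<close> make the added multiples of \<open>x\<close>
      equal, so they cancel.\<close>
    with arg_cong[OF 3, of "\<lambda>v. v $ i"] st show "r $ i = r' $ i"
      using assms x by (simp add: scale_by_def)
  qed (use assms in simp)
  moreover have "s = s'"
  proof -
    have "p = p'" using \<open>r = r'\<close> by (simp add: p_def p'_def)
    with 1 have eq: "4 * (4 * s) = 4 * (4 * s')" by simp
    \<comment> \<open>4 is its own inverse modulo 5, as 16 = 1 + 15; this cancels the factor 4 of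
      the first coordinate.\<close>
    have inv: "a = 4 * (4 * a)" for a :: 5
    proof -
      have "4 * (4 * a) = a + 5 * (3 * a)" by (simp add: algebra_simps)
      then show ?thesis by (simp only: five_times_eq_0 add_0_right)
    qed
    have "s = 4 * (4 * s)" by (rule inv)
    also note eq
    also have "4 * (4 * s') = s'" by (rule inv[symmetric])
    finally show ?thesis .
  qed
  ultimately show ?thesis using st by simp
qed

section \<open>Linear codes made of codewords, and the code generated by the extended matrix\<close>

lemma linear_code_codewords:
  assumes "linear_code n C"
  shows "linear_code (n + 2) {codeword x s t r | s t r. r \<in> C}" (is "linear_code _ ?D")
proof -
  have sub: "r \<in> carrier_vec n" if "r \<in> C" for r
    using assms that by (auto simp: linear_code_def)
  have "?D \<subseteq> carrier_vec (n + 2)"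
    using codeword_carrier sub by blast
  moreover have "0\<^sub>v (n + 2) \<in> ?D"
    using assms codeword_zero[symmetric] unfolding linear_code_def by blast
  moreover have "u + v \<in> ?D" if "u \<in> ?D" "v \<in> ?D" for u v
  proof -
    obtain s t r s' t' r' where "u = codeword x s t r" "r \<in> C" "v = codeword x s' t' r'" "r' \<in> C"
      using \<open>u \<in> ?D\<close> \<open>v \<in> ?D\<close> by blast
    moreover from this have "r + r' \<in> C" using assms by (simp add: linear_code_def)
    ultimately show ?thesis using codeword_add[OF sub sub] by blast
  qed
  moreover have "- u \<in> ?D" if u: "u \<in> ?D" for u
  proof -
    obtain s t r where "u = codeword x s t r" "r \<in> C" using u by blast
    moreover from this have "- r \<in> C" using assms by (simp add: linear_code_def)
    ultimately show ?thesis using codeword_uminus[OF sub] by blast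
  qed
  moreover have "c \<cdot>\<^sub>v u \<in> ?D" if u: "u \<in> ?D" for c u
  proof -
    obtain s t r where "u = codeword x s t r" "r \<in> C" using u by blast
    moreover from this have "c \<cdot>\<^sub>v r \<in> C" using assms by (simp add: linear_code_def)
    ultimately show ?thesis using codeword_smult[OF sub] by blast
  qed
  ultimately show ?thesis unfolding linear_code_def by blast
qed

text \<open>The map \<open>codeword x 0 0\<close> respects sums, negation and ring multiples.
  Minimality of the code generated by \<open>G0\<close> can thus be applied to the preimage of a
  code of length \<open>n + 2\<close>.\<close>

lemma linear_code_preimage:
  assumes "linear_code (n + 2) D"
  shows "linear_code n {r \<in> carrier_vec n. codeword x 0 0 r \<in> D}"
proof -
  have D: "0\<^sub>v (n + 2) \<in> D" "\<And>u v. u \<in> D \<Longrightarrow> v \<in> D \<Longrightarrow> u + v \<in> D"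
    "\<And>u. u \<in> D \<Longrightarrow> - u \<in> D" "\<And>c u. u \<in> D \<Longrightarrow> c \<cdot>\<^sub>v u \<in> D"
    using assms by (auto simp: linear_code_def)
  have "codeword x 0 0 (0\<^sub>v n) \<in> D"
    using D(1) by (simp add: codeword_zero)
  moreover have "codeword x 0 0 (u + v) \<in> D"
    if "u \<in> carrier_vec n" "v \<in> carrier_vec n" "codeword x 0 0 u \<in> D" "codeword x 0 0 v \<in> D" for u v
    using D(2)[OF that(3,4)] that by (simp add: codeword_add)
  moreover have "codeword x 0 0 (- u) \<in> D"
    if "u \<in> carrier_vec n" "codeword x 0 0 u \<in> D" for u
    using D(3)[OF that(2)] that by (simp add: codeword_uminus)
  moreover have "codeword x 0 0 (c \<cdot>\<^sub>v u) \<in> D"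
    if "u \<in> carrier_vec n" "codeword x 0 0 u \<in> D" for c u
    using D(4)[OF that(2)] that by (simp add: codeword_smult)
  ultimately show ?thesis
    by (simp add: linear_code_def)
qed

text \<open>Ring multiples of such a word are zero, so its multiples are built by repeated
  addition.\<close>

lemma codeword_nat_multiple:
  assumes "linear_code (n + 2) D" and "codeword x s t (0\<^sub>v n) \<in> D"
  shows "codeword x (of_nat m * s) (of_nat m * t) (0\<^sub>v n) \<in> D"
proof (induction m)
  case 0
  then show ?case using assms(1) by (simp add: codeword_zero linear_code_def)
next
  case (Suc m)
  have "codeword x s t (0\<^sub>v n) + codeword x (of_nat m * s) (of_nat m * t) (0\<^sub>v n) \<in> D"
    using Suc assms by (simp add: linear_code_def)
  then show ?case by (simp add: codeword_add algebra_simps)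
qed

text \<open>One inclusion is minimality of the generated code. For the other, a codeword splits into
  an \<open>s\<close>-part, a \<open>t\<close>-part and an \<open>r\<close>-part; as
  \<open>j\<close> and \<open>k\<close> are nonzero, repeated addition of each upper row reaches
  every \<open>s\<close> and every \<open>t\<close>.\<close>

lemma code_gen_by_codewords:
  assumes G0: "G0 \<in> carrier_mat m n" and "j \<noteq> 0" "k \<noteq> 0"
    and G: "dim_col G = n + 2"
    and rows: "set (rows G) = {codeword x j 0 (0\<^sub>v n), codeword x 0 k (0\<^sub>v n)}
      \<union> codeword x 0 0 ` set (rows G0)"
  shows "code_gen_by G = {codeword x s t r | s t r. r \<in> code_gen_by G0}"
proof
  have lin0: "linear_code n (code_gen_by G0)"
    using linear_code_code_gen_by[of G0] G0 by simp
  then have zero: "0\<^sub>v n \<in> code_gen_by G0" by (simp add: linear_code_def)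
  show "code_gen_by G \<subseteq> {codeword x s t r | s t r. r \<in> code_gen_by G0}"
  proof (rule code_gen_by_subset)
    show "set (rows G) \<subseteq> {codeword x s t r | s t r. r \<in> code_gen_by G0}"
      using zero rows_subset_code_gen_by[of G0] unfolding rows by blast
  qed (use linear_code_codewords[OF lin0] G in simp)
  have lin: "linear_code (n + 2) (code_gen_by G)"
    using linear_code_code_gen_by[of G] G by simp
  \<comment> \<open>The lower rows of \<open>G\<close> put the rows of \<open>G0\<close> into the
    preimage; minimality extends this to the whole code they generate.\<close>
  have "code_gen_by G0 \<subseteq> {r \<in> carrier_vec n. codeword x 0 0 r \<in> code_gen_by G}"
  proof (rule code_gen_by_subset)
    show "set (rows G0) \<subseteq> {r \<in> carrier_vec n. codeword x 0 0 r \<in> code_gen_by G}"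
      using rows_subset_code_gen_by[of G] G0 unfolding rows by (auto simp: rows_def)
  qed (use linear_code_preimage[OF lin] G0 in simp)
  then have r: "codeword x 0 0 r \<in> code_gen_by G" "r \<in> carrier_vec n"
    if "r \<in> code_gen_by G0" for r using that by auto
  have s: "codeword x s 0 (0\<^sub>v n) \<in> code_gen_by G" for s
  proof -
    obtain i where "s = of_nat i * j" using \<open>j \<noteq> 0\<close> by (rule five_nat_multiple)
    then show ?thesis
      using codeword_nat_multiple[OF lin, of j 0 i] rows_subset_code_gen_by[of G] rows by simp
  qed
  have t: "codeword x 0 t (0\<^sub>v n) \<in> code_gen_by G" for t
  proof -
    obtain i where "t = of_nat i * k" using \<open>k \<noteq> 0\<close> by (rule five_nat_multiple)
    then show ?thesis
      using codeword_nat_multiple[OF lin, of 0 k i] rows_subset_code_gen_by[of G] rows by simp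
  qed
  have "codeword x s t r \<in> code_gen_by G" if "r \<in> code_gen_by G0" for s t r
  proof -
    have "(codeword x s 0 (0\<^sub>v n) + codeword x 0 t (0\<^sub>v n)) + codeword x 0 0 r \<in> code_gen_by G"
      using lin s[of s] t[of t] r(1)[OF that] by (simp add: linear_code_def)
    then show ?thesis using r(2)[OF that] by (simp add: codeword_add)
  qed
  then show "{codeword x s t r | s t r. r \<in> code_gen_by G0} \<subseteq> code_gen_by G" by blast
qed

section \<open>Size and self-orthogonality of the set of codewords\<close>

lemma card_codewords:
  assumes "C \<subseteq> carrier_vec n"
  shows "card {codeword x s t r | s t r. r \<in> C} = 25 * card C"
proof -
  have "{codeword x s t r | s t r. r \<in> C} = (\<lambda>(s, t, r). codeword x s t r) ` (UNIV \<times> UNIV \<times> C)"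
    by force
  moreover have "inj_on (\<lambda>(s, t, r). codeword x s t r) (UNIV \<times> UNIV \<times> C)"
  proof (rule inj_onI, clarsimp)
    fix s t r s' t' r'
    assume "r \<in> C" "r' \<in> C" "codeword x s t r = codeword x s' t' r'"
    then show "s = s' \<and> t = t' \<and> r = r'"
      using assms by (intro codeword_inject) auto
  qed
  ultimately show ?thesis by (simp add: card_image card_cartesian_product)
qed

lemma quasi_self_dual_codewords:
  assumes "quasi_self_dual n C"
  shows "quasi_self_dual (n + 2) {codeword x s t r | s t r. r \<in> C}"
proof -
  have sub: "C \<subseteq> carrier_vec n" using assms by (simp add: quasi_self_dual_def linear_code_def)
  have "self_orthogonal {codeword x s t r | s t r. r \<in> C}"
    unfolding self_orthogonal_def
  proof clarify
    fix s t r s' t' r'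
    assume r: "r \<in> C" "r' \<in> C"
    then have "codeword x s t r \<bullet> codeword x s' t' r' = r \<bullet> r'"
      using sub by (intro codeword_scalar_prod) auto
    also have "\<dots> = 0"
      using assms r by (simp add: quasi_self_dual_def self_orthogonal_def)
    finally show "codeword x s t r \<bullet> codeword x s' t' r' = 0" .
  qed
  \<comment> \<open>The 25 choices of the pair \<open>(s, t)\<close> raise the size from
    \<open>5 ^ n\<close> to \<open>5 ^ (n + 2)\<close>.\<close>
  then show ?thesis
    using assms linear_code_codewords card_codewords[OF sub] by (simp add: quasi_self_dual_def)
qed

section \<open>Rows of the block matrix as codewords\<close>

lemma rows_extension:
  fixes j k :: 5 and G0 :: "i5 mat"
  defines "A \<equiv> mat_of_rows_list 2 [[4 *\<^sub>5 I5 0 j, 0], [0, 2 *\<^sub>5 I5 0 k]]"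
    and "B \<equiv> mat_of_rows n [scale_by (I5 0 j) x, scale_by (I5 0 k) x]"
    and "E \<equiv> mat_of_rows_list 2 (map (\<lambda>r. [mixed_prod x r, 2 *\<^sub>5 mixed_prod x r]) (rows G0))"
  assumes G0: "G0 \<in> carrier_mat m n"
  shows "set (rows (four_block_mat A B E G0)) =
    {codeword x j 0 (0\<^sub>v n), codeword x 0 k (0\<^sub>v n)} \<union> codeword x 0 0 ` set (rows G0)"
proof -
  let ?G = "four_block_mat A B E G0"
  have dims: "A \<in> carrier_mat 2 2" "B \<in> carrier_mat 2 n" "E \<in> carrier_mat m 2"
    using G0 by (auto simp: A_def B_def E_def mat_of_rows_list_def)
  note row = row_four_block_mat[OF dims G0]
  have sc: "scale_by c x \<in> carrier_vec n" for c using x by (simp add: scale_by_def)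
  \<comment> \<open>The left blocks have two columns, so appending to one of their rows amounts to
    prepending two entries, the shape used in \<open>codeword\<close>.\<close>
  have v2: "v @\<^sub>v w = vCons (v $ 0) (vCons (v $ 1) w)" if "dim_vec v = 2" for v w :: "i5 vec"
  proof (rule eq_vecI)
    fix i assume "i < dim_vec (vCons (v $ 0) (vCons (v $ 1) w))"
    moreover have "i = 0 \<or> i = 1 \<or> (\<exists>l. i = Suc (Suc l))"
      by (metis One_nat_def not0_implies_Suc)
    ultimately show "(v @\<^sub>v w) $ i = vCons (v $ 0) (vCons (v $ 1) w) $ i"
      using that by (elim disjE exE) (simp_all add: vec_index_vCons)
  qed (use that in simp)
  have r0: "row ?G 0 = codeword x j 0 (0\<^sub>v n)"
    using row(1)[of 0] dims sc
    by (simp add: v2 codeword_def A_def B_def mat_of_rows_list_def mat_of_rows_row)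
      (simp add: i5.expand)
  have r1: "row ?G 1 = codeword x 0 k (0\<^sub>v n)"
    using row(1)[of 1] dims sc
    by (simp add: v2 codeword_def A_def B_def mat_of_rows_list_def mat_of_rows_row)
      (simp add: i5.expand)
  \<comment> \<open>The shift by 2 skips the two rows of the upper blocks.\<close>
  have r: "row ?G (i + 2) = codeword x 0 0 (row G0 i)" if "i < m" for i
    using row(2)[of "i + 2"] dims sc G0 that
    by (simp add: v2 codeword_def E_def mat_of_rows_list_def scale_by_zero)
      (simp add: i5.expand)
  have split: "{0..<2 + m} = {0, 1} \<union> (\<lambda>i. i + 2) ` {0..<m}"
    unfolding image_add_atLeastLessThan' by auto
  have dim: "dim_row ?G = 2 + m"
    using dims G0 by simp
  have "set (rows ?G) = row ?G ` {0..<2 + m}"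
    unfolding rows_def dim by (simp only: set_map set_upt)
  also have "\<dots> = {row ?G 0, row ?G 1} \<union> (\<lambda>i. row ?G (i + 2)) ` {0..<m}"
    unfolding split by (simp add: image_image)
  also have "(\<lambda>i. row ?G (i + 2)) ` {0..<m} = codeword x 0 0 ` set (rows G0)"
    using G0 r by (simp add: rows_def image_image)
  finally show ?thesis unfolding r0 r1 .
qed

end

theorem theorem3p9:
  fixes n m :: nat and C0 :: "i5 vec set" and G0 G :: "i5 mat" and x :: "5 vec" and \<mu> \<nu> :: i5
  assumes "G0 \<in> carrier_mat m n"
    and "C0 = code_gen_by G0"
    and "quasi_self_dual n C0"
    and "x \<in> carrier_vec n"
    and "\<mu> \<in> J5" and "\<mu> \<noteq> 0" and "\<nu> \<in> J5" and "\<nu> \<noteq> 0"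
    and "G = four_block_mat
      (mat_of_rows_list 2 [[4 *\<^sub>5 \<mu>, 0], [0, 2 *\<^sub>5 \<nu>]])
      (mat_of_rows n [scale_by \<mu> x, scale_by \<nu> x])
      (mat_of_rows_list 2 (map (\<lambda>r. [mixed_prod x r, 2 *\<^sub>5 mixed_prod x r]) (rows G0)))
      G0"
  shows "quasi_self_dual (n + 2) (code_gen_by G)"
proof -
  \<comment> \<open>Nonzero elements of the maximal ideal are replaced by their b-coefficients,
    which are nonzero modulo 5 and hence invertible.\<close>
  obtain j where j: "\<mu> = I5 0 j" "j \<noteq> 0" using assms(5,6) by (rule J5_nonzeroE)
  obtain k where k: "\<nu> = I5 0 k" "k \<noteq> 0" using assms(7,8) by (rule J5_nonzeroE)
  have "dim_col G = n + 2"
    using assms(1) by (simp add: assms(9) mat_of_rows_list_def)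
  moreover have "set (rows G) = {codeword x j 0 (0\<^sub>v n), codeword x 0 k (0\<^sub>v n)}
      \<union> codeword x 0 0 ` set (rows G0)"
    unfolding assms(9) j(1) k(1) by (rule rows_extension[OF assms(4,1)])
  ultimately have "code_gen_by G = {codeword x s t r | s t r. r \<in> C0}"
    unfolding assms(2) by (rule code_gen_by_codewords[OF assms(4,1) j(2) k(2)])
  then show ?thesis
    using quasi_self_dual_codewords[OF assms(4,3)] by simp
qed

end
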